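(* Let $n>2$ be an integer and let $S=\{s_1,\dots,s_n\}$ be a set of positive real numbers with $s_1<\cdots<s_n$. Let ${\bf M}_S=(\max(s_i,s_j))_{i,j=1}^n$ and ${\bf N}_S=(\min(s_i,s_j))_{i,j=1}^n$. Then the generalized eigenvalues of ${\bf M}_S$ to ${\bf N}_S$, counted with multiplicity, are $$\lambda_1=\sqrt{\frac{s_n}{s_1}},\quad \lambda_2=\cdots=\lambda_{n-1}=-1,\quad \lambda_n=-\sqrt{\frac{s_n}{s_1}}.$$
   Context: For complex Hermitian $n\times n$ matrices ${\bf A}$ and ${\bf B}$ with ${\bf B}$ positive definite, a generalized eigenvalue of ${\bf A}$ to ${\bf B}$ is a number $\lambda$ such that ${\bf A}{\bf x}=\lambda{\bf B}{\bf x}$ for some nonzero ${\bf x}\in\mathbb{C}^n$. Equivalently, the generalized eigenvalues are the roots $\lambda$ of $\det({\bf A}-\lambda{\bf B})=0$, counted with multiplicity; there are $n$ of them and all are real. The matrix ${\bf N}_S$ is positive definite for every finite set $S$ of distinct positive real numbers. *)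

theory Defs
  imports Complex_Main
    "HOL-Computational_Algebra.Polynomial"
    "Jordan_Normal_Form.Char_Poly"
begin

definition gen_eigenvalue :: "complex mat \<Rightarrow> complex mat \<Rightarrow> complex \<Rightarrow> bool" where
  "gen_eigenvalue A B k \<longleftrightarrow>
     (\<exists>v \<in> carrier_vec (dim_row A). v \<noteq> 0\<^sub>v (dim_row A) \<and> A *\<^sub>v v = k \<cdot>\<^sub>v (B *\<^sub>v v))"

(* det (A - X B), as a polynomial in X *)
definition gen_char_poly :: "complex mat \<Rightarrow> complex mat \<Rightarrow> complex poly" where
  "gen_char_poly A B =
     det (map_mat (\<lambda>a. [:a:]) A - [:0, 1:] \<cdot>\<^sub>m map_mat (\<lambda>b. [:b:]) B)"

(* The generalized eigenvalues with multiplicity. Meaningful only when gen_char_poly A B is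
   nonzero, for instance when B is positive definite: proots 0 is empty. *)
definition gen_eigenvalues :: "complex mat \<Rightarrow> complex mat \<Rightarrow> complex multiset" where
  "gen_eigenvalues A B = proots (gen_char_poly A B)"

(* The elements of S are listed as s 1 < ... < s n, whereas matrix indices start at 0. *)
definition max_mat :: "nat \<Rightarrow> (nat \<Rightarrow> real) \<Rightarrow> complex mat" where
  "max_mat n s = mat n n (\<lambda>(i, j). complex_of_real (max (s (i + 1)) (s (j + 1))))"

definition min_mat :: "nat \<Rightarrow> (nat \<Rightarrow> real) \<Rightarrow> complex mat" where
  "min_mat n s = mat n n (\<lambda>(i, j). complex_of_real (min (s (i + 1)) (s (j + 1))))"

lemma poly_gen_char_poly:
  assumes A: "A \<in> carrier_mat n n" and B: "B \<in> carrier_mat n n"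
  shows "poly (gen_char_poly A B) k = det (A - k \<cdot>\<^sub>m B)"
proof -
  have h: "comm_ring_hom (\<lambda>p :: complex poly. poly p k)"
    by unfold_locales auto
  have "map_mat (\<lambda>p. poly p k) (map_mat (\<lambda>a. [:a:]) A - [:0, 1:] \<cdot>\<^sub>m map_mat (\<lambda>b. [:b:]) B)
      = A - k \<cdot>\<^sub>m B"
    using A B by (intro eq_matI) auto
  then show ?thesis
    unfolding gen_char_poly_def by (metis comm_ring_hom.hom_det[OF h])
qed

lemma gen_eigenvalue_iff_root:
  assumes A: "A \<in> carrier_mat n n" and B: "B \<in> carrier_mat n n"
  shows "gen_eigenvalue A B k \<longleftrightarrow> poly (gen_char_poly A B) k = 0"
proof -
  have C: "A - k \<cdot>\<^sub>m B \<in> carrier_mat n n"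
    using A B by auto
  have "(A - k \<cdot>\<^sub>m B) *\<^sub>v v = 0\<^sub>v n \<longleftrightarrow> A *\<^sub>v v = k \<cdot>\<^sub>v (B *\<^sub>v v)"
    if v: "v \<in> carrier_vec n" for v
  proof -
    have kB: "(k \<cdot>\<^sub>m B) *\<^sub>v v = k \<cdot>\<^sub>v (B *\<^sub>v v)"
      using B v by (intro eq_vecI) auto
    have "(A - k \<cdot>\<^sub>m B) *\<^sub>v v = A *\<^sub>v v - k \<cdot>\<^sub>v (B *\<^sub>v v)"
      using minus_mult_distrib_mat_vec[OF A _ v, of "k \<cdot>\<^sub>m B"] B kB by simp
    moreover have "A *\<^sub>v v \<in> carrier_vec n" "k \<cdot>\<^sub>v (B *\<^sub>v v) \<in> carrier_vec n"
      using A B v by auto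
    moreover have "x - y = 0\<^sub>v n \<longleftrightarrow> x = y"
      if "x \<in> carrier_vec n" "y \<in> carrier_vec n" for x y :: "complex vec"
      using that by (auto simp: vec_eq_iff)
    ultimately show ?thesis
      by simp
  qed
  then show ?thesis
    using A unfolding poly_gen_char_poly[OF A B] det_0_iff_vec_prod_zero[OF C]
      gen_eigenvalue_def by auto
qed

end

theory Submission
  imports Defs
begin

text \<open>
  The polynomial \<open>det (M - k N)\<close> in \<open>k\<close> has a closed form, in which the roots are visible. Write
  \<open>d i = s (i + 1) - s i\<close> for the gaps. Two consecutive rows of \<open>M\<close> differ by the gap to the left of
  the diagonal and agree from the diagonal on; for \<open>N\<close> it is the other way round. Such a step
  function has a single jump, so after differencing the rows and then the columns, which does not
  change the determinant (\<open>det_row_differences\<close>, \<open>det_column_differences\<close>), only the diagonal, the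
  first row and the first column survive: \<open>M - k N\<close> becomes an arrowhead matrix with corner
  \<open>(1 - k) * s 1\<close>, both arms equal to the list of gaps, and diagonal entries \<open>- (1 + k) * d i\<close>.

  Because the arms are proportional to the diagonal, adding all other columns to \<open>1 + k\<close> times the
  first one makes an arrowhead triangular (\<open>det_arrowhead\<close>). The gaps add up to \<open>s n - s 1\<close>, so the
  new corner is \<open>(1 + k) * (1 - k) * s 1 + (s n - s 1) = s n - k\<^sup>2 * s 1\<close>. The column operation
  multiplied the determinant by \<open>1 + k\<close>; dividing by this factor gives
  \<open>det (M - k N) = (\<Prod>i = 1..<n. - d i) * (1 + k) ^ (n - 2) * (s n - k\<^sup>2 * s 1)\<close>
  (\<open>gen_char_poly_max_min\<close>). The gaps are nonzero, so the roots are \<open>-1\<close>, \<open>n - 2\<close> times, and the two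
  square roots of \<open>s n / s 1\<close>.
\<close>

section \<open>Differencing and arrowhead determinants\<close>

text \<open>
  Differencing the rows is multiplication by a unit lower triangular matrix from the left.
\<close>

lemma det_row_differences:
  fixes f :: "nat \<Rightarrow> nat \<Rightarrow> 'a :: idom"
  shows "det (mat n n (\<lambda>(i, j). f i j)) =
         det (mat n n (\<lambda>(i, j). if i = 0 then f i j else f i j - f (i - 1) j))"
    (is "det ?A = det ?B")
proof -
  define L :: "'a mat" where
    "L = mat n n (\<lambda>(i, k). (if k = i then 1 else 0) - (if i > 0 \<and> k = i - 1 then 1 else 0))"
  have L: "L \<in> carrier_mat n n"
    by (simp add: L_def)
  have "det L = prod_list (diag_mat L)"
    by (rule det_lower_triangular[OF _ L]) (auto simp: L_def)
  also have "\<dots> = 1"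
    using L by (auto simp: prod_list_diag_prod L_def intro!: prod.neutral)
  finally have det_L: "det L = 1" .
  have "L * ?A = ?B"
  proof (rule eq_matI)
    fix i j assume "i < dim_row ?B" "j < dim_col ?B"
    then have ij: "i < n" "j < n"
      by auto
    then have "(L * ?A) $$ (i, j) = (\<Sum>k<n.
        ((if k = i then 1 else 0) - (if i > 0 \<and> k = i - 1 then 1 else 0)) * f k j)"
      by (simp add: L_def scalar_prod_def atLeast0LessThan)
    also have "\<dots> = (\<Sum>k<n. if k = i then f k j else 0)
        - (\<Sum>k<n. if k = i - 1 then (if i > 0 then f k j else 0) else 0)"
      unfolding sum_subtractf[symmetric] by (intro sum.cong) auto
    also have "\<dots> = ?B $$ (i, j)"
      using ij by (auto simp: sum.delta)
    finally show "(L * ?A) $$ (i, j) = ?B $$ (i, j)" .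
  qed (use L in auto)
  then have "det ?B = det L * det ?A"
    using det_mult[OF L, of ?A] by simp
  then show ?thesis
    using det_L by simp
qed

lemma det_column_differences:
  fixes f :: "nat \<Rightarrow> nat \<Rightarrow> 'a :: idom"
  shows "det (mat n n (\<lambda>(i, j). f i j)) =
         det (mat n n (\<lambda>(i, j). if j = 0 then f i j else f i j - f i (j - 1)))"
proof -
  have flip: "det (mat n n (\<lambda>(i, j). g i j)) = det (mat n n (\<lambda>(i, j). g j i))"
    for g :: "nat \<Rightarrow> nat \<Rightarrow> 'a"
  proof -
    have "transpose_mat (mat n n (\<lambda>(i, j). g i j)) = mat n n (\<lambda>(i, j). g j i)"
      by (intro eq_matI) auto
    then show ?thesis
      using det_transpose[of "mat n n (\<lambda>(i, j). g i j)" n] by simp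
  qed
  show ?thesis
    using flip[of f] det_row_differences[of n "\<lambda>i j. f j i"]
      flip[of "\<lambda>i j. if j = 0 then f i j else f i j - f i (j - 1)"] by simp
qed

text \<open>
  Row \<open>i > 0\<close> has only the entries \<open>d i\<close> and \<open>- q * d i\<close>, so \<open>q\<close> times the first column plus all
  other columns vanishes there. The factor \<open>q\<close> on the left is the price of this column operation,
  which is multiplication by a triangular matrix of determinant \<open>q\<close>.
\<close>

lemma det_arrowhead:
  fixes d :: "nat \<Rightarrow> 'a :: idom" and a q :: 'a
  assumes "n > 0"
  shows "q * det (mat n n (\<lambda>(i, j). if i = 0 then if j = 0 then a else d j
                             else if j = 0 then d i else if i = j then - q * d i else 0)) =
         (q * a + (\<Sum>i = 1..<n. d i)) * (\<Prod>i = 1..<n. - q * d i)"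
    (is "q * det ?A = _")
proof -
  define E :: "'a mat" where
    "E = mat n n (\<lambda>(i, j). if j = 0 then if i = 0 then q else 1 else if i = j then 1 else 0)"
  define T :: "'a mat" where
    "T = mat n n (\<lambda>(i, j). if i = 0 then if j = 0 then q * a + (\<Sum>i = 1..<n. d i) else d j
                             else if i = j then - q * d i else 0)"
  have E: "E \<in> carrier_mat n n" and T: "T \<in> carrier_mat n n"
    by (simp_all add: E_def T_def)
  have first: "{0..<n} = insert 0 {1..<n}"
    using assms by auto
  have "det E = prod_list (diag_mat E)"
    by (rule det_lower_triangular[OF _ E]) (auto simp: E_def)
  also have "\<dots> = q"
    using assms by (simp add: prod_list_diag_prod E_def first)
  finally have det_E: "det E = q" .
  have "det T = prod_list (diag_mat T)"
    by (rule det_upper_triangular[OF _ T]) (auto simp: T_def upper_triangular_def)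
  also have "\<dots> = (q * a + (\<Sum>i = 1..<n. d i)) * (\<Prod>i = 1..<n. - q * d i)"
    using assms by (simp add: prod_list_diag_prod T_def first)
  finally have det_T: "det T = \<dots>" .
  have "?A * E = T"
  proof (rule eq_matI)
    fix i j assume "i < dim_row T" "j < dim_col T"
    then have ij: "i < n" "j < n"
      by (auto simp: T_def)
    have "(?A * E) $$ (i, j) = (\<Sum>k = 0..<n. ?A $$ (i, k) * E $$ (k, j))"
      using ij by (simp add: E_def scalar_prod_def)
    also have "\<dots> = ?A $$ (i, 0) * E $$ (0, j) + (\<Sum>k = 1..<n. ?A $$ (i, k) * E $$ (k, j))"
      by (simp add: first)
    also have "\<dots> = T $$ (i, j)"
    proof (cases "j = 0")
      case True
      have "(\<Sum>k = 1..<n. ?A $$ (i, k) * E $$ (k, j)) =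
          (\<Sum>k = 1..<n. if i = 0 then d k else if k = i then - q * d k else 0)"
        using ij True by (intro sum.cong) (auto simp: E_def)
      then show ?thesis
        using ij True assms by (auto simp: E_def T_def sum.delta mult.commute)
    next
      case False
      have "(\<Sum>k = 1..<n. ?A $$ (i, k) * E $$ (k, j)) =
          (\<Sum>k = 1..<n. if k = j then ?A $$ (i, k) else 0)"
        using ij False by (intro sum.cong) (auto simp: E_def)
      then show ?thesis
        using ij False assms by (auto simp: E_def T_def sum.delta)
    qed
    finally show "(?A * E) $$ (i, j) = T $$ (i, j)" .
  qed (use E T in auto)
  then have "det T = det ?A * det E"
    using det_mult[OF _ E, of ?A] by simp
  then show ?thesis
    using det_E det_T by (simp add: mult.commute)
qed

section \<open>The generalized characteristic polynomial of max and min matrices\<close>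

text \<open>
  Monotonicity decides every maximum and minimum by the order of the indices, which makes the row
  differences of the pencil step functions. Matrix indices start at 0, so the entry at \<open>i\<close> belongs
  to \<open>s (i + 1)\<close>, and row \<open>i\<close> differs from row \<open>i - 1\<close> by the gap \<open>s (i + 1) - s i\<close>.
\<close>

lemma det_max_min_pencil:
  fixes s :: "nat \<Rightarrow> real" and k :: complex
  assumes n: "n > 0" and mono: "mono_on {1..n} s"
  shows "(1 + k) * det (max_mat n s - k \<cdot>\<^sub>m min_mat n s) =
         (complex_of_real (s n) - k\<^sup>2 * complex_of_real (s 1)) *
         (\<Prod>i = 1..<n. - (1 + k) * complex_of_real (s (i + 1) - s i))"
proof -
  define f where "f i j = complex_of_real (max (s (i + 1)) (s (j + 1)))
      - k * complex_of_real (min (s (i + 1)) (s (j + 1)))" for i j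
  define d where "d i = complex_of_real (s (i + 1) - s i)" for i
  define g where "g i j = (if i = 0 then f i j else f i j - f (i - 1) j)" for i j
  have le: "s (i + 1) \<le> s (j + 1)" if "i \<le> j" "j < n" for i j
    using mono that by (auto simp: mono_on_def)
  have f_le: "f i j = s (j + 1) - k * s (i + 1)" if "i \<le> j" "j < n" for i j
    using le[OF that] by (simp add: f_def max_absorb2 min_absorb1)
  have f_ge: "f i j = s (i + 1) - k * s (j + 1)" if "j \<le> i" "i < n" for i j
    using le[OF that] by (simp add: f_def max_absorb1 min_absorb2)
  have g_row: "g i j = (if j < i then d i else - k * d i)" if "0 < i" "i < n" "j < n" for i j
    using that by (auto simp: g_def f_le f_ge d_def algebra_simps)
  (* Row i > 0 of g jumps from d i to - k * d i at the diagonal; its only nonzero column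
     difference is that jump. *)
  have arrow: "(if j = 0 then g i j else g i j - g i (j - 1)) =
      (if i = 0 then if j = 0 then (1 - k) * s 1 else d j
       else if j = 0 then d i else if i = j then - (1 + k) * d i else 0)"
    if "i < n" "j < n" for i j
  proof (cases "i = 0")
    case True
    then show ?thesis
      using that by (auto simp: g_def f_le d_def algebra_simps)
  next
    case False
    then show ?thesis
      using that by (auto simp: g_row algebra_simps)
  qed
  have "max_mat n s - k \<cdot>\<^sub>m min_mat n s = mat n n (\<lambda>(i, j). f i j)"
    by (intro eq_matI) (auto simp: max_mat_def min_mat_def f_def)
  then have "det (max_mat n s - k \<cdot>\<^sub>m min_mat n s) = det (mat n n (\<lambda>(i, j). g i j))"
    by (simp add: det_row_differences[of n f] g_def)
  also have "\<dots> = det (mat n n (\<lambda>(i, j). if j = 0 then g i j else g i j - g i (j - 1)))"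
    by (rule det_column_differences)
  also have "mat n n (\<lambda>(i, j). if j = 0 then g i j else g i j - g i (j - 1)) =
      mat n n (\<lambda>(i, j). if i = 0 then if j = 0 then (1 - k) * s 1 else d j
       else if j = 0 then d i else if i = j then - (1 + k) * d i else 0)"
    by (intro eq_matI) (use arrow in auto)
  finally have "(1 + k) * det (max_mat n s - k \<cdot>\<^sub>m min_mat n s) =
      ((1 + k) * ((1 - k) * s 1) + (\<Sum>i = 1..<n. d i)) * (\<Prod>i = 1..<n. - (1 + k) * d i)"
    using det_arrowhead[OF n, of "1 + k" "(1 - k) * s 1" d] by simp
  also have "(\<Sum>i = 1..<n. d i) = complex_of_real (s n) - complex_of_real (s 1)"
    using n sum_Suc_diff'[of 1 n "\<lambda>i. complex_of_real (s i)"] by (simp add: d_def)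
  also have "(1 + k) * ((1 - k) * s 1) + (complex_of_real (s n) - complex_of_real (s 1)) =
      complex_of_real (s n) - k\<^sup>2 * complex_of_real (s 1)"
    by (simp add: power2_eq_square algebra_simps)
  finally show ?thesis
    by (simp only: d_def)
qed

text \<open>
  At \<open>k = -1\<close> both sides of \<open>det_max_min_pencil\<close> vanish, so the factor \<open>1 + k\<close> cannot be cancelled
  pointwise. Read as an identity of polynomials it can, and this also keeps the multiplicity of
  the root \<open>-1\<close> correct.
\<close>

lemma gen_char_poly_max_min:
  fixes s :: "nat \<Rightarrow> real"
  assumes n: "n \<ge> 2" and mono: "mono_on {1..n} s"
  shows "gen_char_poly (max_mat n s) (min_mat n s) =
         Polynomial.smult (\<Prod>i = 1..<n. - complex_of_real (s (i + 1) - s i))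
           ([:1, 1:] ^ (n - 2) * [:complex_of_real (s n), 0, - complex_of_real (s 1):])"
    (is "?p = Polynomial.smult ?c (?l ^ _ * ?r)")
proof -
  have carrier: "max_mat n s \<in> carrier_mat n n" "min_mat n s \<in> carrier_mat n n"
    by (simp_all add: max_mat_def min_mat_def)
  have "poly (?l * ?p) k = poly (?l * Polynomial.smult ?c (?l ^ (n - 2) * ?r)) k" for k
  proof -
    have "poly (?l * ?p) k =
        (complex_of_real (s n) - k\<^sup>2 * complex_of_real (s 1)) *
        (\<Prod>i = 1..<n. (1 + k) * - complex_of_real (s (i + 1) - s i))"
      using n det_max_min_pencil[OF _ mono, of k, unfolded minus_mult_commute]
      by (simp add: poly_gen_char_poly[OF carrier] distrib_right)
    also have "\<dots> = (complex_of_real (s n) - k\<^sup>2 * complex_of_real (s 1)) * ((1 + k) ^ (n - 1) * ?c)"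
      by (simp only: prod.distrib prod_constant card_atLeastLessThan)
    also have "n - 1 = Suc (n - 2)"
      using n by simp
    finally show ?thesis
      by (simp add: power2_eq_square algebra_simps)
  qed
  then have "?l * ?p = ?l * Polynomial.smult ?c (?l ^ (n - 2) * ?r)"
    by (intro poly_eq_poly_eq_iff[THEN iffD1] ext)
  then show ?thesis
    by (subst (asm) mult_cancel_left) simp
qed

theorem theorem1:
  fixes n :: nat and s :: "nat \<Rightarrow> real"
  assumes "n > 2"
    and "\<And>i. i \<in> {1..n} \<Longrightarrow> s i > 0"
    and "strict_mono_on {1..n} s"
  shows "(\<forall>k. gen_eigenvalue (max_mat n s) (min_mat n s) k \<longleftrightarrow>
            k \<in> {complex_of_real (sqrt (s n / s 1)), - 1, - complex_of_real (sqrt (s n / s 1))})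
       \<and> gen_eigenvalues (max_mat n s) (min_mat n s) =
            {#complex_of_real (sqrt (s n / s 1))#} + replicate_mset (n - 2) (- 1)
              + {#- complex_of_real (sqrt (s n / s 1))#}"
proof -
  define r where "r = complex_of_real (sqrt (s n / s 1))"
  define c where "c = (\<Prod>i = 1..<n. - complex_of_real (s (i + 1) - s i))"
  let ?p = "gen_char_poly (max_mat n s) (min_mat n s)"
  have pos: "s 1 > 0" "s n > 0"
    using assms(1,2) by auto
  have "(sqrt (s n / s 1))\<^sup>2 = s n / s 1"
    using pos by simp
  then have "r * r = complex_of_real (s n / s 1)"
    unfolding r_def power2_eq_square by (metis of_real_mult)
  then have r: "complex_of_real (s 1) * (r * r) = complex_of_real (s n)"
    using pos by simp
  have "s i \<noteq> s (i + 1)" if "i \<in> {1..<n}" for i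
    using strict_mono_onD[OF assms(3), of i "i + 1"] that by auto
  then have c: "c \<noteq> 0"
    by (auto simp: c_def)
  have "?p = Polynomial.smult c ([:1, 1:] ^ (n - 2)
      * [:complex_of_real (s n), 0, - complex_of_real (s 1):])"
    using assms(1) gen_char_poly_max_min[OF _ strict_mono_on_imp_mono_on[OF assms(3)]]
    by (simp add: c_def)
  also have "[:complex_of_real (s n), 0, - complex_of_real (s 1):] =
      Polynomial.smult (- complex_of_real (s 1)) ([:- r, 1:] * [:r, 1:])"
    using r by simp
  finally have p: "?p = Polynomial.smult (c * - complex_of_real (s 1))
      ([:- r, 1:] * [:1, 1:] ^ (n - 2) * [:r, 1:])"
    by (simp only: mult_smult_right smult_smult mult_ac)
  have p0: "?p \<noteq> 0"
    using c pos by (simp add: p del: mult_pCons_left mult_pCons_right)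
  have "proots ?p = {#r#} + replicate_mset (n - 2) (- 1) + {#- r#}"
    unfolding p using c pos
    by (simp add: proots_mult proots_power multiset_eq_iff
        del: mult_pCons_left mult_pCons_right)
  then have eigenvalues: "gen_eigenvalues (max_mat n s) (min_mat n s) =
      {#r#} + replicate_mset (n - 2) (- 1) + {#- r#}"
    by (simp add: gen_eigenvalues_def)
  have carrier: "max_mat n s \<in> carrier_mat n n" "min_mat n s \<in> carrier_mat n n"
    by (simp_all add: max_mat_def min_mat_def)
  have "gen_eigenvalue (max_mat n s) (min_mat n s) k \<longleftrightarrow> k \<in> {r, - 1, - r}" for k
  proof -
    have "gen_eigenvalue (max_mat n s) (min_mat n s) k \<longleftrightarrow>
        k \<in># gen_eigenvalues (max_mat n s) (min_mat n s)"
      using p0 by (simp add: gen_eigenvalue_iff_root[OF carrier] gen_eigenvalues_def)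
    also have "\<dots> \<longleftrightarrow> k \<in> {r, - 1, - r}"
      using assms(1) by (auto simp: eigenvalues)
    finally show ?thesis .
  qed
  with eigenvalues show ?thesis
    by (simp add: r_def)
qed

end
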